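(* Let $(c_k)_{k\ge0}$ be the integer sequence with $c_{2k}=(-1)^kC_k$ and $c_{2k+1}=0$ for all $k\ge0$, where $C_k=\frac{1}{k+1}\binom{2k}{k}$ is the $k$-th Catalan number. Let $H_1=(c_{i+j})_{i,j\ge0}$ and $H_2=(c_{i+j}\bmod 2)_{i,j\ge0}$, both regarded as matrices over $\mathbb Z$ (with $c_{i+j}\bmod 2\in\{0,1\}$). Then for every $n\in\mathbb N$, the upper left $n\times n$ submatrices $H_1^{(n)}=(c_{i+j})_{0\le i,j<n}$ and $H_2^{(n)}=(c_{i+j}\bmod 2)_{0\le i,j<n}$ satisfy $\det(H_1^{(n)})=\pm1$ and $\det(H_2^{(n)})=\pm1$. *)

theory Defs
  imports "Jordan_Normal_Form.Determinant"
begin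

definition catalan :: "nat \<Rightarrow> nat" where
  "catalan k = ((2 * k) choose k) div (k + 1)"

(* The division on nat above is exact. *)
lemma catalan_mult: "(k + 1) * catalan k = (2 * k) choose k"
proof -
  have "Suc k * ((2 * k) choose Suc k) = k * ((2 * k) choose k)"
    using binomial_absorb_comp[of "2 * k" k] binomial_absorption[of k "2 * k"]
    by (metis add_diff_cancel_right' mult_2)
  hence "(2 * k) choose k = Suc k * (((2 * k) choose k) - ((2 * k) choose Suc k))"
    by (simp add: diff_mult_distrib2)
  hence "Suc k dvd ((2 * k) choose k)"
    by (rule dvdI)
  thus ?thesis
    unfolding catalan_def Suc_eq_plus1 by (rule dvd_mult_div_cancel)
qed

lemma of_nat_catalan:
  "(of_nat (catalan k) :: 'a :: field_char_0) = 1 / of_nat (k + 1) * of_nat ((2 * k) choose k)"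
proof -
  have "(of_nat (k + 1) :: 'a) * of_nat (catalan k) = of_nat ((2 * k) choose k)"
    by (metis catalan_mult of_nat_mult)
  moreover have "(of_nat (k + 1) :: 'a) \<noteq> 0"
    by (metis Suc_eq_plus1 of_nat_neq_0)
  ultimately show ?thesis
    by (simp add: field_simps del: of_nat_add of_nat_Suc)
qed

(* Matrices with rows and columns indexed by all natural numbers are functions of two indices. *)
definition hankel :: "(nat \<Rightarrow> 'a) \<Rightarrow> nat \<Rightarrow> nat \<Rightarrow> 'a" where
  "hankel c = (\<lambda>i j. c (i + j))"

definition upper_left_submatrix :: "(nat \<Rightarrow> nat \<Rightarrow> 'a) \<Rightarrow> nat \<Rightarrow> 'a mat" where
  "upper_left_submatrix H n = mat n n (\<lambda>(i, j). H i j)"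

end

theory Submission imports Defs begin

text \<open>
  The sequence \<open>c\<close> consists of the signed numbers of Dyck paths, in which every down step has
  weight \<open>-1\<close>. Cutting a path of length \<open>i + j\<close> after \<open>i\<close> steps factors \<open>H\<^sub>1\<close> as a product of a
  lower and an upper triangular matrix, with \<open>1\<close> and \<open>\<plusminus>1\<close> on the respective diagonals.

  Since \<open>C\<^sub>k\<close> is odd iff \<open>k + 1\<close> is a power of two, the entry \<open>(i, j)\<close> of \<open>H\<^sub>2\<close> is \<open>1\<close> iff \<open>i + j + 2\<close>
  is a power of two. There is exactly one permutation of \<open>{0..<n}\<close> that only meets such entries:
  if \<open>2 ^ a \<le> n < 2 ^ (a + 1)\<close>, it must reflect the indices \<open>i \<ge> 2 ^ (a + 1) - n - 1\<close> by
  \<open>i \<mapsto> 2 ^ (a + 1) - 2 - i\<close>, and the remaining indices are dealt with by induction. Hence the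
  Leibniz formula for the determinant has a single nonzero term.
\<close>

section \<open>The signed Catalan numbers\<close>

text \<open>\<open>signed_ballot i k\<close> counts nonnegative paths of length \<open>i\<close> from height \<open>0\<close> to height \<open>k\<close>,
  each path with sign \<open>-1\<close> to the number of its down steps.\<close>

fun signed_ballot :: "nat \<Rightarrow> nat \<Rightarrow> int" where
  "signed_ballot 0 k = (if k = 0 then 1 else 0)"
| "signed_ballot (Suc i) 0 = - signed_ballot i 1"
| "signed_ballot (Suc i) (Suc k) = signed_ballot i k - signed_ballot i (k + 2)"

lemma signed_ballot_eq_0: "i < k \<Longrightarrow> signed_ballot i k = 0"
  by (induction i k rule: signed_ballot.induct) auto

lemma signed_ballot_diag: "signed_ballot i i = 1"
  by (induction i) (auto simp: signed_ballot_eq_0)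

lemma signed_ballot_odd: "odd (i + k) \<Longrightarrow> signed_ballot i k = 0"
  by (induction i k rule: signed_ballot.induct) (auto simp: odd_pos)

text \<open>Reflection principle: of the paths with \<open>r\<close> down steps, those that reach
  \<open>-1\<close> are subtracted. Counting their reflections by up steps gives
  \<open>j + r + 1\<close>, which avoids \<open>r - 1\<close> at \<open>r = 0\<close>.\<close>

lemma signed_ballot_binomial:
  "i = j + 2 * r \<Longrightarrow>
    signed_ballot i j = (-1) ^ r * (int (i choose r) - int (i choose (j + r + 1)))"
proof (induction i j arbitrary: r rule: signed_ballot.induct)
  case (1 k)
  then show ?case by simp
next
  case (2 i)
  then obtain s where r: "r = Suc s" by (cases r) auto
  with 2 have "i = 1 + 2 * s" by simp
  from "2.IH"[OF this] show ?case using r by (simp add: algebra_simps)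
next
  case (3 i k)
  show ?case
  proof (cases r)
    case 0
    then have "i = k" using "3.prems" by simp
    then show ?thesis using 0 by (simp add: signed_ballot_diag signed_ballot_eq_0)
  next
    case (Suc s)
    then have "i = k + 2 * r" "i = k + 2 + 2 * s" using "3.prems" by auto
    from "3.IH"(1)[OF this(1)] "3.IH"(2)[OF this(2)] Suc show ?thesis
      by (simp add: algebra_simps)
  qed
qed

text \<open>Brings \<open>catalan\<close> into the form that the reflection principle yields at
  height \<open>0\<close>.\<close>

lemma catalan_eq_binomial_diff:
  "int (catalan k) = int ((2 * k) choose k) - int ((2 * k) choose (k + 1))"
proof -
  have "Suc k * ((2 * k) choose Suc k) = k * ((2 * k) choose k)"
    using binomial_absorb_comp[of "2 * k" k] binomial_absorption[of k "2 * k"]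
    by (metis add_diff_cancel_right' mult_2)
  then have "int (k + 1) * int ((2 * k) choose (k + 1)) = int k * int ((2 * k) choose k)"
    by (metis Suc_eq_plus1 of_nat_mult)
  moreover have "int (k + 1) * int (catalan k) = int ((2 * k) choose k)"
    by (metis catalan_mult of_nat_mult)
  ultimately have "int (k + 1) * int (catalan k) =
      int (k + 1) * (int ((2 * k) choose k) - int ((2 * k) choose (k + 1)))"
    by (simp add: algebra_simps)
  then show ?thesis
    by (metis Suc_eq_plus1 mult_cancel_left of_nat_neq_0)
qed

lemma signed_ballot_catalan: "signed_ballot (2 * k) 0 = (-1) ^ k * int (catalan k)"
  by (simp add: signed_ballot_binomial[of "2 * k" 0 k] catalan_eq_binomial_diff)

text \<open>The difference of the two sums telescopes.\<close>

lemma signed_ballot_shift: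
  assumes "i \<le> N" "j \<le> N"
  shows "(\<Sum>k\<le>N. signed_ballot (Suc i) k * ((-1) ^ k * signed_ballot j k)) =
         (\<Sum>k\<le>N. signed_ballot i k * ((-1) ^ k * signed_ballot (Suc j) k))"
proof -
  have "(\<Sum>k\<le>M. signed_ballot (Suc i) k * ((-1) ^ k * signed_ballot j k)) -
        (\<Sum>k\<le>M. signed_ballot i k * ((-1) ^ k * signed_ballot (Suc j) k)) =
        (-1) ^ M * (signed_ballot i M * signed_ballot j (Suc M)
          - signed_ballot i (Suc M) * signed_ballot j M)" for M
    by (induction M) (simp_all add: algebra_simps)
  \<comment> \<open>Both products in the boundary term have a factor at height \<open>Suc N\<close>,
    out of reach in \<open>i\<close> or \<open>j\<close> steps.\<close>
  from this[of N] show ?thesis using assms by (simp add: signed_ballot_eq_0)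
qed

text \<open>Here \<open>k\<close> is the height at the cut. Reversing the second piece swaps up and
  down steps, whose numbers differ by \<open>k\<close>; hence the sign \<open>(-1) ^ k\<close>. The
  induction moves the cut one step at a time to the start of the path.\<close>

lemma signed_ballot_convolution:
  "i + j \<le> N \<Longrightarrow>
    (\<Sum>k\<le>N. signed_ballot i k * ((-1) ^ k * signed_ballot j k)) = signed_ballot (i + j) 0"
proof (induction i arbitrary: j)
  case 0
  have "(\<Sum>k\<le>N. signed_ballot 0 k * ((-1) ^ k * signed_ballot j k)) =
        (\<Sum>k\<le>N. if k = 0 then signed_ballot j 0 else 0)"
    by (rule sum.cong) auto
  then show ?case by simp
next
  case (Suc i)
  then show ?case using signed_ballot_shift[of i N j] Suc.IH[of "Suc j"] by simp
qed

lemma abs_det_hankel_signed_ballot: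
  "\<bar>det (upper_left_submatrix (hankel (\<lambda>k. signed_ballot k 0)) n)\<bar> = 1"
proof -
  define L where "L = mat n n (\<lambda>(i, k). signed_ballot i k)"
  define U where "U = mat n n (\<lambda>(k, j). (-1) ^ k * signed_ballot j k)"
  have L: "L \<in> carrier_mat n n" and U: "U \<in> carrier_mat n n"
    by (auto simp: L_def U_def)
  have "upper_left_submatrix (hankel (\<lambda>k. signed_ballot k 0)) n = L * U"
  proof (rule eq_matI)
    fix i j assume "i < dim_row (L * U)" "j < dim_col (L * U)"
    then have ij: "i < n" "j < n" using L U by auto
    have "(L * U) $$ (i, j) = (\<Sum>k<n. signed_ballot i k * ((-1) ^ k * signed_ballot j k))"
      using ij by (simp add: L_def U_def scalar_prod_def lessThan_atLeast0)
    \<comment> \<open>Heights from \<open>n\<close> on contribute zero, and the larger bound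
      dominates \<open>i + j\<close>.\<close>
    also have "\<dots> = (\<Sum>k\<le>n + n. signed_ballot i k * ((-1) ^ k * signed_ballot j k))"
      using ij by (intro sum.mono_neutral_left) (auto simp: signed_ballot_eq_0)
    also have "\<dots> = signed_ballot (i + j) 0"
      using ij by (intro signed_ballot_convolution) simp
    finally show "upper_left_submatrix (hankel (\<lambda>k. signed_ballot k 0)) n $$ (i, j) =
        (L * U) $$ (i, j)"
      using ij by (simp add: upper_left_submatrix_def hankel_def)
  qed (use L U in \<open>auto simp: upper_left_submatrix_def\<close>)
  then have "det (upper_left_submatrix (hankel (\<lambda>k. signed_ballot k 0)) n) = det L * det U"
    using det_mult[OF L U] by simp
  moreover have "det L = 1"
    using det_lower_triangular[OF _ L]
    by (simp add: prod_list_diag_prod L_def signed_ballot_eq_0 signed_ballot_diag)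
  moreover have "det U = (\<Prod>k = 0..<n. (-1) ^ k)"
    using det_upper_triangular[OF _ U]
    by (simp add: prod_list_diag_prod U_def upper_triangular_def signed_ballot_eq_0
        signed_ballot_diag)
  ultimately show ?thesis by (simp add: abs_prod power_abs)
qed

section \<open>Parity of the Catalan numbers\<close>

lemma catalan_Suc: "(k + 2) * catalan (Suc k) = 2 * (2 * k + 1) * catalan k"
proof -
  have 1: "Suc k * ((2 * k + 2) choose Suc k) = (2 * k + 2) * ((2 * k + 1) choose k)"
    using Suc_times_binomial_eq[of "2 * k + 1" k] by (simp add: mult.commute)
  have 2: "Suc k * ((2 * k + 1) choose k) = (2 * k + 1) * ((2 * k) choose k)"
    using binomial_absorb_comp[of "2 * k + 1" k] by simp
  \<comment> \<open>Each factor \<open>k + 1\<close> pays for one absorption identity.\<close>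
  have "(k + 1) * ((k + 1) * ((k + 2) * catalan (Suc k))) =
      (k + 1) * (Suc k * ((2 * k + 2) choose Suc k))"
    using catalan_mult[of "Suc k"] by simp
  also have "\<dots> = (2 * k + 2) * (Suc k * ((2 * k + 1) choose k))"
    unfolding 1 by (simp only: ac_simps Suc_eq_plus1)
  also have "\<dots> = (k + 1) * ((k + 1) * (2 * (2 * k + 1) * catalan k))"
    unfolding 2 catalan_mult[symmetric] by (simp add: algebra_simps)
  finally show ?thesis by (metis Suc_eq_plus1 mult_cancel_left nat.distinct(1))
qed

text \<open>In the recurrence leading to \<open>k\<close> the left factor \<open>k + 1\<close> is
  odd, while the right side is even.\<close>

lemma even_catalan: "even k \<Longrightarrow> 0 < k \<Longrightarrow> even (catalan k)"
proof -
  assume k: "even k" "0 < k"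
  then obtain l where l: "k = Suc l" by (cases k) auto
  have "even ((l + 2) * catalan k)" unfolding l catalan_Suc by simp
  then show ?thesis using k l by simp
qed

text \<open>Up to odd factors, two steps of the recurrence at \<open>2 * m + 1\<close> agree with one step at \<open>m\<close>.\<close>

lemma catalan_double: "\<exists>a b. odd a \<and> odd b \<and> a * catalan (2 * m + 1) = b * catalan m"
proof (induction m)
  case 0
  have "catalan 0 = 1" "catalan 1 = 1"
    using catalan_mult[of 0] catalan_mult[of 1] by simp_all
  then show ?case by (intro exI[of _ 1]) simp
next
  case (Suc m)
  then obtain a b where ab: "odd a" "odd b" "a * catalan (2 * m + 1) = b * catalan m" by blast
  let ?C = "catalan (2 * m + 3)" and ?D = "catalan (2 * m + 2)" and ?E = "catalan (2 * m + 1)"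
  let ?c = "catalan (m + 1)" and ?d = "catalan m"
  have D: "(2 * m + 3) * ?D = 2 * (4 * m + 3) * ?E"
    using catalan_Suc[of "2 * m + 1"] by (simp add: numeral_eq_Suc)
  have C: "(2 * m + 4) * ?C = 2 * (4 * m + 5) * ?D"
    using catalan_Suc[of "2 * m + 2"] by (simp add: numeral_eq_Suc)
  have c: "(m + 2) * ?c = 2 * (2 * m + 1) * ?d"
    using catalan_Suc[of m] by simp
  have "(2 * (m + 2)) * (a * (2 * m + 1) * (2 * m + 3) * ?C)
      = a * (2 * m + 1) * (2 * m + 3) * ((2 * m + 4) * ?C)"
    by (simp only: distrib_left ac_simps)
  also have "\<dots> = a * (2 * m + 1) * 2 * (4 * m + 5) * ((2 * m + 3) * ?D)"
    unfolding C by (simp only: ac_simps)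
  also have "\<dots> = (2 * m + 1) * 2 * (4 * m + 5) * 2 * (4 * m + 3) * (a * ?E)"
    unfolding D by (simp only: ac_simps)
  also have "\<dots> = 2 * (4 * m + 5) * (4 * m + 3) * b * (2 * (2 * m + 1) * ?d)"
    unfolding ab(3) by (simp only: ac_simps)
  also have "\<dots> = (2 * (m + 2)) * ((4 * m + 5) * (4 * m + 3) * b * ?c)"
    unfolding c[symmetric] by (simp only: ac_simps)
  finally have "a * (2 * m + 1) * (2 * m + 3) * ?C = (4 * m + 5) * (4 * m + 3) * b * ?c"
    by (simp only: mult_cancel_left) simp
  moreover have "odd (a * (2 * m + 1) * (2 * m + 3))" "odd ((4 * m + 5) * (4 * m + 3) * b)"
    using ab by simp_all
  moreover have "2 * Suc m + 1 = 2 * m + 3" "Suc m = m + 1" by simp_all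
  ultimately show ?case by metis
qed

lemma odd_catalan_iff: "odd (catalan k) \<longleftrightarrow> (\<exists>a. k + 1 = 2 ^ a)"
proof (induction k rule: less_induct)
  case (less k)
  consider "k = 0" | "even k" "0 < k" | m where "k = 2 * m + 1"
    by (metis gr0I oddE)
  then show ?case
  proof cases
    case 1
    then show ?thesis by (auto simp: catalan_def intro: exI[of _ 0])
  next
    case 2
    have "k + 1 \<noteq> 2 ^ a" for a
      using 2 by (cases a) (auto, metis even_Suc even_mult_iff even_numeral)
    then show ?thesis using even_catalan[OF 2] by blast
  next
    case 3
    from catalan_double[of m] have "odd (catalan k) \<longleftrightarrow> odd (catalan m)"
      unfolding 3 by (metis even_mult_iff)
    also have "\<dots> \<longleftrightarrow> (\<exists>a. m + 1 = 2 ^ a)" using less 3 by simp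
    also have "\<dots> \<longleftrightarrow> (\<exists>a. k + 1 = 2 ^ a)"
    proof
      assume "\<exists>a. m + 1 = 2 ^ a"
      then obtain a where "m + 1 = 2 ^ a" ..
      then have "k + 1 = 2 ^ Suc a" using 3 by simp
      then show "\<exists>a. k + 1 = 2 ^ a" ..
    next
      assume "\<exists>a. k + 1 = 2 ^ a"
      then obtain a where a: "k + 1 = 2 ^ a" ..
      with 3 obtain b where "a = Suc b" by (cases a) auto
      with a 3 have "m + 1 = 2 ^ b" by simp
      then show "\<exists>a. m + 1 = 2 ^ a" ..
    qed
    finally show ?thesis .
  qed
qed

section \<open>Permutations with prescribed sums\<close>

definition pow2_sums :: "nat \<Rightarrow> (nat \<Rightarrow> nat) \<Rightarrow> bool" where
  "pow2_sums n p \<longleftrightarrow> p permutes {0..<n} \<and> (\<forall>i<n. \<exists>a. i + p i + 2 = 2 ^ a)"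

text \<open>For \<open>i < n < s\<close>, the condition \<open>s - n \<le> i + 1\<close> says
  exactly that the mirror image \<open>s - 2 - i\<close> is below \<open>n\<close>.\<close>

definition reflect :: "nat \<Rightarrow> nat \<Rightarrow> nat \<Rightarrow> nat" where
  "reflect n s i = (if s - n \<le> i + 1 \<and> i < n then s - 2 - i else i)"

lemma reflect_reflect: "n < s \<Longrightarrow> s \<le> 2 * n \<Longrightarrow> reflect n s (reflect n s i) = i"
  by (auto simp: reflect_def)

lemma reflect_permutes: "n < s \<Longrightarrow> s \<le> 2 * n \<Longrightarrow> reflect n s permutes {0..<n}"
  unfolding permutes_def
  by (metis atLeastLessThan_iff le0 reflect_def reflect_reflect)

text \<open>The sum lies strictly between \<open>2 ^ a\<close> and \<open>2 ^ (a + 2)\<close>, which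
  leaves one power of two.\<close>

lemma pow2_sum_eq:
  fixes i j n a :: nat
  assumes "i < n" "j < n" "n < 2 ^ (a + 1)" "2 ^ a \<le> i + 1" "i + j + 2 = 2 ^ b"
  shows "i + j + 2 = 2 ^ (a + 1)"
proof -
  have "(2::nat) ^ a < 2 ^ b" using assms by linarith
  then have "a < b" using power_less_imp_less_exp[of "2::nat" a b] by simp
  have "(2::nat) ^ b < 2 ^ (a + 2)" using assms by simp
  then have "b < a + 2" using power_less_imp_less_exp[of "2::nat" b "a + 2"] by simp
  then have "b = a + 1" using \<open>a < b\<close> by simp
  then show ?thesis using assms by simp
qed

lemma pow2_sums_reflect:
  assumes p: "pow2_sums n p" and a: "2 ^ a \<le> n" "n < 2 ^ (a + 1)"
    and i: "2 ^ (a + 1) - n \<le> i + 1" "i < n"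
  shows "p i = reflect n (2 ^ (a + 1)) i"
proof -
  let ?s = "2 ^ (a + 1) :: nat"
  have perm: "p permutes {0..<n}" using p by (simp add: pow2_sums_def)
  have lt: "p k < n" if "k < n" for k
    using permutes_in_image[OF perm, of k] that by simp
  show ?thesis
  proof (cases "2 ^ a \<le> i + 1")
    case True
    then have "i + p i + 2 = ?s"
      using p i a lt pow2_sum_eq[of i n "p i" a] by (auto simp: pow2_sums_def)
    then show ?thesis using i by (simp add: reflect_def)
  next
    case False
    \<comment> \<open>The value at a small \<open>i\<close> is not forced directly, but its mirror
      image \<open>j\<close> is large, so \<open>pow2_sum_eq\<close> forces the preimage of
      \<open>j\<close> to be \<open>i\<close>.\<close>
    define j where "j = ?s - 2 - i"
    have j: "j < n" "2 ^ a \<le> j + 1" using False i a by (auto simp: j_def)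
    obtain k where pk: "p k = j" using permutes_surj[OF perm] by (metis surjD)
    have k: "k < n" using permutes_in_image[OF perm, of k] pk j by simp
    then obtain b where "k + p k + 2 = 2 ^ b" using p by (auto simp: pow2_sums_def)
    then have "j + k + 2 = 2 ^ b" using pk by simp
    from pow2_sum_eq[OF j(1) k a(2) j(2) this] have "k = i"
      using False j by (auto simp: j_def)
    then show ?thesis using pk i by (simp add: reflect_def j_def)
  qed
qed

lemma ex1_pow2_sums: "\<exists>!p. pow2_sums n p"
proof (induction n rule: less_induct)
  case (less n)
  show ?case
  proof (cases "n = 0")
    case True
    then show ?thesis by (auto simp: pow2_sums_def)
  next
    case False
    then obtain a where a: "2 ^ a \<le> n" "n < 2 ^ (a + 1)"
      using ex_power_ivl1[of 2 n] by auto
    define s where "s = (2 ^ (a + 1) :: nat)"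
    \<comment> \<open>The first reflected index; \<open>s \<le> 2 * n\<close> makes it smaller than
      \<open>n\<close>, so the induction hypothesis applies.\<close>
    define m where "m = s - n - 1"
    define r where "r = reflect n s"
    have s: "n < s" "s \<le> 2 * n" using a by (auto simp: s_def)
    have m: "m < n" using s by (simp add: m_def)
    have r_perm: "r permutes {0..<n}" and rr: "r (r i) = i" for i
      using s by (auto simp: r_def reflect_permutes reflect_reflect)
    have r_low: "r i = i" if "i < m" for i
      using that by (auto simp: r_def reflect_def m_def)
    have r_high: "i + r i + 2 = s" if "m \<le> i" "i < n" for i
      using that s by (auto simp: r_def reflect_def m_def)
    obtain q where q: "pow2_sums m q" and q_unique: "\<And>q'. pow2_sums m q' \<Longrightarrow> q' = q"
      using less[OF m] by auto
    have q_perm: "q permutes {0..<m}" using q by (simp add: pow2_sums_def)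
    have q_low: "q i < m" if "i < m" for i
      using permutes_in_image[OF q_perm, of i] that by simp
    have q_high: "q i = i" if "m \<le> i" for i
      using permutes_not_in[OF q_perm, of i] that by simp
    have "pow2_sums n (r \<circ> q)"
      unfolding pow2_sums_def
    proof (intro conjI allI impI)
      have "q permutes {0..<n}" using permutes_subset[OF q_perm] m by auto
      then show "r \<circ> q permutes {0..<n}" using r_perm by (rule permutes_compose)
      fix i assume i: "i < n"
      show "\<exists>b. i + (r \<circ> q) i + 2 = 2 ^ b"
      proof (cases "i < m")
        case True
        then show ?thesis using q q_low[of i] r_low[of "q i"] by (simp add: pow2_sums_def)
      next
        case False
        then show ?thesis using q_high[of i] r_high[of i] i
          by (intro exI[of _ "a + 1"]) (simp add: s_def)
      qed
    qed
    \<comment> \<open>Composing with the involution \<open>r\<close> undoes the forced part of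
      \<open>p\<close>; what remains permutes \<open>{0..<m}\<close>.\<close>
    moreover have "p = r \<circ> q" if p: "pow2_sums n p" for p
    proof -
      have high: "(r \<circ> p) i = i" if "i \<in> {0..<n} - {0..<m}" for i
      proof -
        have "p i = r i"
          unfolding r_def s_def
          using that pow2_sums_reflect[OF p a] s by (auto simp: m_def s_def)
        then show ?thesis using rr by simp
      qed
      have "r \<circ> p permutes {0..<n}"
        using p r_perm by (auto simp: pow2_sums_def intro: permutes_compose)
      then have perm: "r \<circ> p permutes {0..<m}"
        using high by (rule permutes_superset)
      \<comment> \<open>\<open>r (p i)\<close> is below \<open>m\<close>, hence fixed by
        \<open>r\<close>, and \<open>r\<close> is an involution. So the sums for
        \<open>i < m\<close> do not change.\<close>
      have "r (p i) = p i" if "i < m" for i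
        using permutes_in_image[OF perm, of i] that r_low[of "r (p i)"] rr[of "p i"] by simp
      then have "pow2_sums m (r \<circ> p)"
        using p perm m by (simp add: pow2_sums_def)
      then have "r \<circ> p = q" by (rule q_unique)
      then show ?thesis using rr by auto
    qed
    ultimately show ?thesis by blast
  qed
qed

lemma abs_det_pow2_sums:
  fixes H :: "nat \<Rightarrow> nat \<Rightarrow> int"
  assumes H: "\<And>i j. H i j = (if \<exists>a. i + j + 2 = 2 ^ a then 1 else 0)"
  shows "\<bar>det (upper_left_submatrix H n)\<bar> = 1"
proof -
  obtain q where q: "pow2_sums n q" and q_unique: "\<And>p. pow2_sums n p \<Longrightarrow> p = q"
    using ex1_pow2_sums[of n] by auto
  have q_perm: "q permutes {0..<n}" using q by (simp add: pow2_sums_def)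
  have summand: "(\<Prod>i = 0..<n. upper_left_submatrix H n $$ (i, p i)) = (if p = q then 1 else 0)"
    if p: "p permutes {0..<n}" for p
  proof -
    have "(\<Prod>i = 0..<n. upper_left_submatrix H n $$ (i, p i)) = (\<Prod>i = 0..<n. H i (p i))"
      using permutes_in_image[OF p] by (intro prod.cong) (auto simp: upper_left_submatrix_def)
    also have "\<dots> = (if p = q then 1 else 0)"
    proof (cases "p = q")
      case True
      then show ?thesis using q by (auto simp: H pow2_sums_def intro!: prod.neutral)
    next
      case False
      then have "\<exists>i<n. \<not> (\<exists>a. i + p i + 2 = 2 ^ a)"
        using q_unique[of p] p by (auto simp: pow2_sums_def)
      then show ?thesis using False by (auto simp: H intro!: prod_zero)
    qed
    finally show ?thesis .
  qed
  have "upper_left_submatrix H n \<in> carrier_mat n n"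
    by (simp add: upper_left_submatrix_def)
  then have "det (upper_left_submatrix H n) =
      (\<Sum>p | p permutes {0..<n}. signof p * (if p = q then 1 else 0))"
    unfolding det_def'[OF \<open>_ \<in> carrier_mat n n\<close>] by (intro sum.cong) (simp_all add: summand)
  also have "\<dots> = (\<Sum>p | p permutes {0..<n}. if p = q then signof q else 0)"
    by (intro sum.cong) auto
  also have "\<dots> = signof q"
    using q_perm by (simp add: sum.delta finite_permutations)
  finally show ?thesis by (cases q rule: sign_cases) simp_all
qed

section \<open>Both determinants\<close>

theorem theorem2:
  fixes c :: "nat \<Rightarrow> int" and H\<^sub>1 H\<^sub>2 :: "nat \<Rightarrow> nat \<Rightarrow> int" and n :: nat
  assumes c_even: "\<And>k. c (2 * k) = (-1) ^ k * int (catalan k)"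
    and c_odd: "\<And>k. c (2 * k + 1) = 0"
    and H1: "H\<^sub>1 = hankel c"
    and H2: "H\<^sub>2 = hankel (\<lambda>k. c k mod 2)"
  shows "det (upper_left_submatrix H\<^sub>1 n) \<in> {1, -1} \<and>
         det (upper_left_submatrix H\<^sub>2 n) \<in> {1, -1}"
proof -
  have c: "c = (\<lambda>k. signed_ballot k 0)"
  proof
    fix k
    show "c k = signed_ballot k 0"
      by (cases "even k")
        (auto elim!: evenE oddE simp: c_even signed_ballot_catalan
          c_odd[unfolded Suc_eq_plus1[symmetric]] signed_ballot_odd simp del: signed_ballot.simps)
  qed
  have "c k mod 2 = (if \<exists>a. k + 2 = 2 ^ a then 1 else 0)" for k
  proof (cases "even k")
    case True
    then obtain l where l: "k = 2 * l" by (rule evenE)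
    have "odd (c k) \<longleftrightarrow> (\<exists>a. l + 1 = 2 ^ a)"
      by (simp only: l c_even odd_catalan_iff[symmetric]) simp
    also have "\<dots> \<longleftrightarrow> (\<exists>a. k + 2 = 2 ^ a)"
    proof
      assume "\<exists>a. l + 1 = 2 ^ a"
      then obtain a where "l + 1 = 2 ^ a" ..
      then have "k + 2 = 2 ^ Suc a" using l by simp
      then show "\<exists>a. k + 2 = 2 ^ a" ..
    next
      assume "\<exists>a. k + 2 = 2 ^ a"
      then obtain a where a: "k + 2 = 2 ^ a" ..
      then obtain b where "a = Suc b" by (cases a) auto
      with a l have "l + 1 = 2 ^ b" by simp
      then show "\<exists>a. l + 1 = 2 ^ a" ..
    qed
    finally show ?thesis by (metis not_mod_2_eq_1_eq_0 odd_iff_mod_2_eq_one)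
  next
    case False
    \<comment> \<open>\<open>k + 2\<close> is odd and exceeds \<open>1\<close>.\<close>
    then have "k + 2 \<noteq> 2 ^ a" for a
      by (cases a) (auto, metis even_Suc even_mult_iff even_numeral)
    moreover have "c k = 0" using False c_odd by (auto elim: oddE)
    ultimately show ?thesis by simp
  qed
  then have "\<bar>det (upper_left_submatrix H\<^sub>2 n)\<bar> = 1"
    unfolding H2 hankel_def by (intro abs_det_pow2_sums) (simp add: add.assoc)
  moreover have "\<bar>det (upper_left_submatrix H\<^sub>1 n)\<bar> = 1"
    unfolding H1 c by (rule abs_det_hankel_signed_ballot)
  ultimately show ?thesis by auto
qed

end
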